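(* Let $\mathcal{H}$ be a real Hilbert space, $A:\mathcal{H}\to\mathcal{H}$ a single-valued operator and $B:\mathcal{H}\rightrightarrows\mathcal{H}$ a set-valued operator such that the solution set $S:=\{x\in\mathcal{H}: 0\in A(x)+B(x)\}$ is nonempty. Let $v:\mathcal{H}\to\mathcal{H}$ be a mapping such that the pairs $(A,v)$ and $(B,v)$ are monotone, and let $\gamma>0$ be such that $\operatorname{ran}(\gamma B+v)=\mathcal{H}$. Suppose that the pair $(B,v)$ is $\alpha$-strongly monotone for some $\alpha>0$, that the pair $(A,v)$ is $L$-Lipschitz continuous and $v$ is $L_v$-Lipschitz continuous for some $L,L_v>0$, and that $$\gamma<\alpha L^{-2}L_v^{-2}.$$ Let $(x_k)_{k\ge 0}$ be any sequence with $x_0\in\mathcal{H}$ and $$x_{k+1}\in(\gamma B+v)^{-1}\bigl(v(x_k)-\gamma A(x_k)\bigr),\qquad k\ge 0.$$ Then, for $x^*\in S$, the sequence $(v(x_k))$ converges linearly to $v(x^* )$.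
   Context: For a set-valued operator $F:\mathcal{H}\rightrightarrows\mathcal{H}$: $\operatorname{ran}F=\bigcup_{x\in\mathcal{H}}F(x)$ and $F^{-1}(y)=\{x\in\mathcal{H}: y\in F(x)\}$. A single-valued map is identified with the set-valued operator taking singleton values. A pair $(F_1,F_2)$ of operators $F_1,F_2:\mathcal{H}\rightrightarrows\mathcal{H}$ is monotone if $\langle x_1^*-y_1^*,x_2^*-y_2^*\rangle\ge 0$ for all $x,y\in\mathcal{H}$, $x_1^*\in F_1(x)$, $y_1^*\in F_1(y)$, $x_2^*\in F_2(x)$, $y_2^*\in F_2(y)$. It is $\alpha$-strongly monotone ($\alpha>0$) if, for all such choices, $\langle x_1^*-y_1^*,x_2^*-y_2^*\rangle\ge\alpha\|x-y\|^2$. The pair $(A,v)$ is $L$-Lipschitz continuous if $\|Ax-Ay\|\le L\|v(x)-v(y)\|$ for all $x,y\in\mathcal{H}$. A sequence $(z_k)$ converges linearly to $z$ if there are $C\ge 0$ and $q\in[0,1)$ such that $\|z_k-z\|\le Cq^k$ for all $k\ge 0$. *)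

theory Defs
  imports "HOL-Analysis.Analysis" "HOL-Library.Set_Algebras"
begin

text \<open>Set-valued operators \<open>'a \<rightrightarrows> 'a\<close> are functions \<open>'a \<Rightarrow> 'a set\<close>; values may be empty.\<close>

type_synonym 'a setop = "'a \<Rightarrow> 'a set"

definition of_map :: "('a \<Rightarrow> 'a) \<Rightarrow> 'a setop" where
  "of_map f = (\<lambda>x. {f x})"

text \<open>The \<open>+\<close> on the right-hand side is the Minkowski sum of \<open>HOL-Library.Set_Algebras\<close>,
  which is empty as soon as one summand is.\<close>

definition setop_add :: "'a::plus setop \<Rightarrow> 'a setop \<Rightarrow> 'a setop" where
  "setop_add F G = (\<lambda>x. F x + G x)"

definition setop_scale :: "real \<Rightarrow> 'a::real_vector setop \<Rightarrow> 'a setop" where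
  "setop_scale c F = (\<lambda>x. (\<lambda>u. c *\<^sub>R u) ` F x)"

definition setop_ran :: "'a setop \<Rightarrow> 'a set" where
  "setop_ran F = (\<Union>x. F x)"

definition setop_inv :: "'a setop \<Rightarrow> 'a setop" where
  "setop_inv F = (\<lambda>y. {x. y \<in> F x})"

definition solution_set :: "('a::real_vector \<Rightarrow> 'a) \<Rightarrow> 'a setop \<Rightarrow> 'a set" where
  "solution_set A B = {x. 0 \<in> setop_add (of_map A) B x}"

definition monotone_pair :: "'a::real_inner setop \<Rightarrow> 'a setop \<Rightarrow> bool" where
  "monotone_pair F1 F2 \<longleftrightarrow>
     (\<forall>x y. \<forall>x1 \<in> F1 x. \<forall>y1 \<in> F1 y. \<forall>x2 \<in> F2 x. \<forall>y2 \<in> F2 y.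
        (x1 - y1) \<bullet> (x2 - y2) \<ge> 0)"

definition strongly_monotone_pair :: "real \<Rightarrow> 'a::real_inner setop \<Rightarrow> 'a setop \<Rightarrow> bool" where
  "strongly_monotone_pair \<alpha> F1 F2 \<longleftrightarrow> \<alpha> > 0 \<and>
     (\<forall>x y. \<forall>x1 \<in> F1 x. \<forall>y1 \<in> F1 y. \<forall>x2 \<in> F2 x. \<forall>y2 \<in> F2 y.
        (x1 - y1) \<bullet> (x2 - y2) \<ge> \<alpha> * (norm (x - y))\<^sup>2)"

definition lipschitz_pair :: "real \<Rightarrow> ('a::real_normed_vector \<Rightarrow> 'a) \<Rightarrow> ('a \<Rightarrow> 'a) \<Rightarrow> bool" where
  "lipschitz_pair L A v \<longleftrightarrow> (\<forall>x y. norm (A x - A y) \<le> L * norm (v x - v y))"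

definition converges_linearly :: "(nat \<Rightarrow> 'a::real_normed_vector) \<Rightarrow> 'a \<Rightarrow> bool" where
  "converges_linearly z l \<longleftrightarrow>
     (\<exists>C q. C \<ge> 0 \<and> 0 \<le> q \<and> q < 1 \<and> (\<forall>k. norm (z k - l) \<le> C * q ^ k))"

end

theory Submission
  imports Defs
begin

text \<open>A step of the iteration solves the resolvent equation at \<open>x (Suc k)\<close>, while \<open>- A xs \<in> B xs\<close>.
  Strong monotonicity of \<open>B\<close>, converted by the Lipschitz bound of \<open>v\<close> into a bound in terms of
  \<open>v\<close>, makes the resolvent step a contraction by \<open>1 / (1 + \<gamma> m)\<close> with \<open>m = \<alpha> / L\<^sub>v\<^sup>2\<close>; the
  forward step expands by at most \<open>sqrt (1 + \<gamma>\<^sup>2 L\<^sup>2)\<close>. The product of the two factors is below 1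
  as soon as \<open>\<gamma> L\<^sup>2 < 2 m + \<gamma> m\<^sup>2\<close>.\<close>

lemma mem_solution_set_iff: "z \<in> solution_set A B \<longleftrightarrow> - A z \<in> B z"
proof -
  have "A z + b = 0 \<longleftrightarrow> b = - A z" for b
    by (simp add: add_eq_0_iff)
  then show ?thesis
    by (auto simp: solution_set_def setop_add_def of_map_def set_plus_def eq_commute[of 0])
qed

lemma mem_resolvent_iff:
  "z \<in> setop_inv (setop_add (setop_scale \<gamma> B) (of_map v)) w
     \<longleftrightarrow> (\<exists>b \<in> B z. w = \<gamma> *\<^sub>R b + v z)"
  by (auto simp: setop_inv_def setop_add_def setop_scale_def of_map_def set_plus_def)

lemma converges_linearly_if_contracting:
  fixes z :: "nat \<Rightarrow> 'a::real_normed_vector"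
  assumes "0 \<le> q" "q < 1" and "\<And>k. norm (z (Suc k) - l) \<le> q * norm (z k - l)"
  shows "converges_linearly z l"
proof -
  have "norm (z k - l) \<le> norm (z 0 - l) * q ^ k" for k
  proof (induction k)
    case (Suc k)
    have "norm (z (Suc k) - l) \<le> q * norm (z k - l)" by (rule assms(3))
    also have "\<dots> \<le> q * (norm (z 0 - l) * q ^ k)"
      by (intro mult_left_mono Suc assms(1))
    finally show ?case by (simp add: mult_ac)
  qed simp
  then show ?thesis
    unfolding converges_linearly_def using assms(1,2) norm_ge_zero by blast
qed

text \<open>Since \<open>norm (v y - v y')\<close> is at most \<open>c * norm (y - y')\<close>,
  passing from points to their \<open>v\<close>-values divides the modulus by
  \<open>c\<^sup>2\<close>. The resulting estimate involves distances between values of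
  \<open>v\<close> only, so the iteration can be followed through \<open>v (x k)\<close>
  alone.\<close>

lemma strongly_monotone_pair_lipschitz:
  fixes v :: "'a::real_inner \<Rightarrow> 'a"
  assumes "strongly_monotone_pair \<alpha> B (of_map v)" and "c > 0" and "c-lipschitz_on UNIV v"
    and "b \<in> B y" and "b' \<in> B y'"
  shows "\<alpha> / c\<^sup>2 * (norm (v y - v y'))\<^sup>2 \<le> (b - b') \<bullet> (v y - v y')"
proof -
  have "norm (v y - v y') \<le> c * norm (y - y')"
    using lipschitz_onD[OF assms(3), of y y'] by (simp add: dist_norm)
  then have "(norm (v y - v y'))\<^sup>2 \<le> c\<^sup>2 * (norm (y - y'))\<^sup>2"
    by (metis norm_ge_zero power_mono power_mult_distrib)
  then have "(norm (v y - v y'))\<^sup>2 / c\<^sup>2 \<le> (norm (y - y'))\<^sup>2"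
    using \<open>c > 0\<close> by (simp add: divide_le_eq mult.commute)
  moreover have "\<alpha> > 0" "\<alpha> * (norm (y - y'))\<^sup>2 \<le> (b - b') \<bullet> (v y - v y')"
    using assms(1,4,5) by (auto simp: strongly_monotone_pair_def of_map_def)
  ultimately have "\<alpha> * ((norm (v y - v y'))\<^sup>2 / c\<^sup>2) \<le> (b - b') \<bullet> (v y - v y')"
    by (meson less_imp_le mult_left_mono order_trans)
  then show ?thesis by simp
qed

text \<open>When the square of the left-hand norm is expanded, the cross term is nonpositive because
  \<open>0 \<le> a \<bullet> d\<close>, and the Lipschitz bound controls the term in
  \<open>(norm a)\<^sup>2\<close>. For \<open>a\<close> and \<open>d\<close> the differences of
  \<open>A\<close> and \<open>v\<close> at two points, \<open>d - \<gamma> *\<^sub>R a\<close> is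
  the difference of the forward steps.\<close>

lemma forward_step_expansion:
  fixes a d :: "'a::real_inner"
  assumes "0 \<le> \<gamma>" and "0 \<le> a \<bullet> d" and "norm a \<le> L * norm d"
  shows "norm (d - \<gamma> *\<^sub>R a) \<le> sqrt (1 + \<gamma>\<^sup>2 * L\<^sup>2) * norm d"
proof -
  have "(norm (d - \<gamma> *\<^sub>R a))\<^sup>2 = (norm d)\<^sup>2 - 2 * \<gamma> * (a \<bullet> d) + \<gamma>\<^sup>2 * (norm a)\<^sup>2"
    unfolding power2_norm_eq_inner
    by (simp add: inner_diff inner_commute power2_eq_square algebra_simps)
  also have "\<dots> \<le> (norm d)\<^sup>2 + \<gamma>\<^sup>2 * (L * norm d)\<^sup>2"
  proof -
    have "0 \<le> 2 * \<gamma> * (a \<bullet> d)" using assms by simp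
    moreover have "\<gamma>\<^sup>2 * (norm a)\<^sup>2 \<le> \<gamma>\<^sup>2 * (L * norm d)\<^sup>2"
      using assms(3) by (intro mult_left_mono power_mono) auto
    ultimately show ?thesis by linarith
  qed
  also have "\<dots> = (sqrt (1 + \<gamma>\<^sup>2 * L\<^sup>2) * norm d)\<^sup>2"
    by (simp add: power_mult_distrib algebra_simps)
  finally show ?thesis
    by (rule power2_le_imp_le) simp
qed

text \<open>Cauchy-Schwarz bounds \<open>w \<bullet> e\<close> by \<open>norm w * norm e\<close>,
  and one factor \<open>norm e\<close> cancels unless \<open>e = 0\<close>.\<close>

lemma backward_step_contraction:
  fixes w e :: "'a::real_inner"
  assumes "c > 0" and "c * (norm e)\<^sup>2 \<le> w \<bullet> e"
  shows "norm e \<le> norm w / c"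
proof (cases "e = 0")
  case False
  have "c * norm e * norm e \<le> norm w * norm e"
    using assms(2) norm_cauchy_schwarz[of w e] by (simp add: power2_eq_square mult.assoc)
  then show ?thesis
    using False \<open>c > 0\<close> by (simp add: le_divide_eq mult.commute)
qed (use \<open>c > 0\<close> in simp)

theorem theorem3p2:
  fixes A v :: "'a::{real_inner, complete_space} \<Rightarrow> 'a"
    and B :: "'a setop"
    and \<gamma> \<alpha> L L\<^sub>v :: real
    and x :: "nat \<Rightarrow> 'a"
    and xs :: 'a
  assumes "solution_set A B \<noteq> {}"
    and "monotone_pair (of_map A) (of_map v)"
    and "monotone_pair B (of_map v)"
    and "\<gamma> > 0"
    and "setop_ran (setop_add (setop_scale \<gamma> B) (of_map v)) = UNIV"
    and "\<alpha> > 0"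
    and "strongly_monotone_pair \<alpha> B (of_map v)"
    and "L > 0"
    and "lipschitz_pair L A v"
    and "L\<^sub>v > 0"
    and "L\<^sub>v-lipschitz_on UNIV v"
    and "\<gamma> < \<alpha> * L powi (-2) * L\<^sub>v powi (-2)"
    and "\<And>k. x (Suc k) \<in> setop_inv (setop_add (setop_scale \<gamma> B) (of_map v))
                              (v (x k) - \<gamma> *\<^sub>R A (x k))"
    and "xs \<in> solution_set A B"
  shows "converges_linearly (\<lambda>k. v (x k)) (v xs)"
proof -
  define m where "m = \<alpha> / L\<^sub>v\<^sup>2"
  define q where "q = sqrt (1 + \<gamma>\<^sup>2 * L\<^sup>2) / (1 + \<gamma> * m)"
  have m: "0 < m" using assms(6,10) by (simp add: m_def)
  have c: "0 < 1 + \<gamma> * m" using m \<open>\<gamma> > 0\<close> by (simp add: add_pos_pos)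
  have "\<gamma> < m / L\<^sup>2"
    using assms(12) by (simp add: m_def power_int_minus field_simps)
  then have "\<gamma> * L\<^sup>2 < m"
    using \<open>L > 0\<close> by (simp add: less_divide_eq)
  \<comment> \<open>The factor \<open>\<gamma>\<close> turns the step-size condition into a bound on
    the radicand in \<open>q\<close>.\<close>
  then have "\<gamma> * (\<gamma> * L\<^sup>2) < \<gamma> * m"
    using \<open>\<gamma> > 0\<close> by simp
  then have "1 + \<gamma>\<^sup>2 * L\<^sup>2 < 1 + \<gamma> * m"
    by (simp add: power2_eq_square mult.assoc)
  \<comment> \<open>A number that is at least 1 does not exceed its square; the square is what a
    bound on the root requires.\<close>
  also have "\<dots> \<le> (1 + \<gamma> * m)\<^sup>2"
    using m \<open>\<gamma> > 0\<close> by (intro self_le_power) auto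
  finally have "sqrt (1 + \<gamma>\<^sup>2 * L\<^sup>2) < 1 + \<gamma> * m"
    using c by (intro real_less_lsqrt) auto
  then have "q < 1" using c by (simp add: q_def)
  have "0 \<le> q" using c by (simp add: q_def)
  have "norm (v (x (Suc k)) - v xs) \<le> q * norm (v (x k) - v xs)" for k
  proof -
    define d e a where "d = v (x k) - v xs" and "e = v (x (Suc k)) - v xs"
      and "a = A (x k) - A xs"
    obtain b where b: "b \<in> B (x (Suc k))"
      and step: "v (x k) - \<gamma> *\<^sub>R A (x k) = \<gamma> *\<^sub>R b + v (x (Suc k))"
      using assms(13)[of k] by (auto simp: mem_resolvent_iff)
    have sol: "- A xs \<in> B xs"
      using assms(14) by (simp add: mem_solution_set_iff)
    \<comment> \<open>The element of \<open>B xs\<close> compared with \<open>b\<close> is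
      \<open>- A xs\<close>, hence the double minus.\<close>
    have "m * (norm e)\<^sup>2 \<le> (b - - A xs) \<bullet> e"
      unfolding m_def e_def
      by (rule strongly_monotone_pair_lipschitz[OF assms(7,10,11) b sol])
    then have "\<gamma> * (m * (norm e)\<^sup>2) \<le> \<gamma> * ((b - - A xs) \<bullet> e)"
      using \<open>\<gamma> > 0\<close> by simp
    also have "\<dots> = (\<gamma> *\<^sub>R b + \<gamma> *\<^sub>R A xs) \<bullet> e"
      by (simp add: algebra_simps)
    \<comment> \<open>The resolvent equation eliminates \<open>b\<close>. The summand
      \<open>- e\<close>, paired with \<open>e\<close>, yields the extra
      \<open>(norm e)\<^sup>2\<close> that raises the constant from \<open>\<gamma> * m\<close> to
      \<open>1 + \<gamma> * m\<close>.\<close>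
    also have "\<gamma> *\<^sub>R b + \<gamma> *\<^sub>R A xs = d - \<gamma> *\<^sub>R a - e"
    proof -
      have "\<gamma> *\<^sub>R b = v (x k) - \<gamma> *\<^sub>R A (x k) - v (x (Suc k))"
        using step by simp
      then show ?thesis
        by (simp add: d_def e_def a_def scaleR_diff_right)
    qed
    finally have "(1 + \<gamma> * m) * (norm e)\<^sup>2 \<le> (d - \<gamma> *\<^sub>R a) \<bullet> e"
      by (simp add: power2_norm_eq_inner algebra_simps)
    then have "norm e \<le> norm (d - \<gamma> *\<^sub>R a) / (1 + \<gamma> * m)"
      by (rule backward_step_contraction[OF c])
    also have "\<dots> \<le> sqrt (1 + \<gamma>\<^sup>2 * L\<^sup>2) * norm d / (1 + \<gamma> * m)"
    proof (intro divide_right_mono forward_step_expansion)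
      show "0 \<le> a \<bullet> d"
        using assms(2) by (auto simp: monotone_pair_def of_map_def a_def d_def)
      show "norm a \<le> L * norm d"
        using assms(9) by (simp add: lipschitz_pair_def a_def d_def)
    qed (use \<open>\<gamma> > 0\<close> c in auto)
    finally show ?thesis by (simp add: q_def d_def e_def)
  qed
  with \<open>0 \<le> q\<close> \<open>q < 1\<close> show ?thesis
    by (rule converges_linearly_if_contracting)
qed

end
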